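(* Consider the asymmetric log-GARCH$(1,1)$ model $$\epsilon_t=\sigma_t\eta_t,\qquad \log\sigma_t^2=\omega+\left(\alpha_+1_{\{\epsilon_{t-1}>0\}}+\alpha_-1_{\{\epsilon_{t-1}<0\}}\right)\log\epsilon_{t-1}^2+\beta\log\sigma_{t-1}^2,$$ under the condition $\max\{|\alpha_++\beta|,|\alpha_-+\beta|\}<1$. Assume that the innovations $\eta_t$ are symmetrically distributed, that $E[|\log\eta_0|^2]<\infty$ (where $\log\eta_0$ is read as $\log|\eta_0|$), and that $|\beta|+\frac12(|\alpha_+|+|\alpha_-|)<1$. Then the strictly stationary solution satisfies $$\mathrm{cov}(\eta_{t-1},\log\sigma_t^2)=\frac12(\alpha_+-\alpha_-)\left\{E(|\eta_0|)\,\tau+E(|\eta_0|\log\eta_0^2)\right\},$$ where $$\tau=E\log\sigma_t^2=\frac{\omega+\frac12(\alpha_++\alpha_-)E(\log\eta_0^2)}{1-\beta-\frac12(\alpha_++\alpha_-)}.$$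
   Context: In the model, $t\in\mathbb{Z}$, $\sigma_t>0$, the coefficients $\omega,\alpha_+,\alpha_-,\beta$ are real, and $(\eta_t)_{t\in\mathbb{Z}}$ is an iid sequence of real random variables with $E\eta_0=0$ and $E\eta_0^2=1$. Convention: $\log0=-\infty$, so the log-moment condition entails $P(\eta_0=0)=0$. Symmetrically distributed means that $\eta_0$ and $-\eta_0$ have the same law. If $E\log^+|\log\eta_0^2|<\infty$ and $|\alpha_++\beta|^a|\alpha_-+\beta|^{1-a}<1$ with $a=P(\eta_0>0)$, the model has a unique strictly stationary solution $(\epsilon_t,\sigma_t)_{t\in\mathbb{Z}}$, which is nonanticipative ($\epsilon_t$ is a measurable function of $\{\eta_u:u\le t\}$) and ergodic; this is the solution referred to. *)

theory Defs
  imports "HOL-Probability.Probability"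
begin

definition iid_process :: "'a measure \<Rightarrow> 'b measure \<Rightarrow> ('i \<Rightarrow> 'a \<Rightarrow> 'b) \<Rightarrow> bool" where
  "iid_process M N X \<longleftrightarrow>
     prob_space.indep_vars M (\<lambda>_. N) X UNIV \<and> (\<forall>s t. distr M N (X s) = distr M N (X t))"

definition symmetrically_distributed :: "'a measure \<Rightarrow> ('a \<Rightarrow> real) \<Rightarrow> bool" where
  "symmetrically_distributed M X \<longleftrightarrow> distr M borel (\<lambda>x. - X x) = distr M borel X"

text \<open>Shift invariance of all finite-dimensional distributions.\<close>

definition strictly_stationary :: "'a measure \<Rightarrow> 'b measure \<Rightarrow> (int \<Rightarrow> 'a \<Rightarrow> 'b) \<Rightarrow> bool" where
  "strictly_stationary M N X \<longleftrightarrow>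
     (\<forall>t. X t \<in> measurable M N) \<and>
     (\<forall>J h. finite J \<longrightarrow>
        distr M (Pi\<^sub>M J (\<lambda>_. N)) (\<lambda>x. \<lambda>t\<in>J. X (t + h) x) =
        distr M (Pi\<^sub>M J (\<lambda>_. N)) (\<lambda>x. \<lambda>t\<in>J. X t x))"

definition covariance :: "'a measure \<Rightarrow> ('a \<Rightarrow> real) \<Rightarrow> ('a \<Rightarrow> real) \<Rightarrow> real" where
  "covariance M X Y =
     (\<integral>x. (X x - integral\<^sup>L M X) * (Y x - integral\<^sup>L M Y) \<partial>M)"

text \<open>
  The library sets \<open>ln 0 = 0\<close>, whereas here \<open>log 0 = -\<infinity>\<close>. With the latter convention
  the finiteness of \<open>E (log \<bar>X\<bar>)\<^sup>2\<close> forces \<open>X \<noteq> 0\<close> almost surely.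
\<close>

definition log_abs :: "real \<Rightarrow> ereal" where
  "log_abs y = (if y = 0 then - \<infinity> else ereal (ln \<bar>y\<bar>))"

definition finite_log_second_moment :: "'a measure \<Rightarrow> ('a \<Rightarrow> real) \<Rightarrow> bool" where
  "finite_log_second_moment M X \<longleftrightarrow> (\<integral>\<^sup>+ x. e2ennreal (\<bar>log_abs (X x)\<bar>\<^sup>2) \<partial>M) < \<infinity>"

text \<open>
  At \<open>\<epsilon> (t - 1) x = 0\<close> both indicators vanish, so the value \<open>ln 0 = 0\<close> does not matter.
\<close>

definition asym_log_garch ::
  "'a measure \<Rightarrow> (int \<Rightarrow> 'a \<Rightarrow> real) \<Rightarrow> real \<Rightarrow> real \<Rightarrow> real \<Rightarrow> real \<Rightarrow>
   (int \<Rightarrow> 'a \<Rightarrow> real) \<Rightarrow> (int \<Rightarrow> 'a \<Rightarrow> real) \<Rightarrow> bool" where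
  "asym_log_garch M \<eta> \<omega> \<alpha>p \<alpha>m \<beta> \<epsilon> \<sigma> \<longleftrightarrow>
     (\<forall>t. \<epsilon> t \<in> borel_measurable M \<and> \<sigma> t \<in> borel_measurable M \<and>
       (AE x in M. \<sigma> t x > 0 \<and> \<epsilon> t x = \<sigma> t x * \<eta> t x \<and>
          ln ((\<sigma> t x)\<^sup>2) =
            \<omega> + (\<alpha>p * of_bool (\<epsilon> (t - 1) x > 0) + \<alpha>m * of_bool (\<epsilon> (t - 1) x < 0))
                  * ln ((\<epsilon> (t - 1) x)\<^sup>2)
              + \<beta> * ln ((\<sigma> (t - 1) x)\<^sup>2)))"

text \<open>
  Under the hypotheses of the theorem, strictly stationary solutions are almost surely unique
  (and nonanticipative and ergodic), so these two properties are not part of the definition.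
\<close>

definition strictly_stationary_solution ::
  "'a measure \<Rightarrow> (int \<Rightarrow> 'a \<Rightarrow> real) \<Rightarrow> real \<Rightarrow> real \<Rightarrow> real \<Rightarrow> real \<Rightarrow>
   (int \<Rightarrow> 'a \<Rightarrow> real) \<Rightarrow> (int \<Rightarrow> 'a \<Rightarrow> real) \<Rightarrow> bool" where
  "strictly_stationary_solution M \<eta> \<omega> \<alpha>p \<alpha>m \<beta> \<epsilon> \<sigma> \<longleftrightarrow>
     asym_log_garch M \<eta> \<omega> \<alpha>p \<alpha>m \<beta> \<epsilon> \<sigma> \<and>
     strictly_stationary M borel (\<lambda>t x. (\<epsilon> t x, \<sigma> t x))"

end

theory Submission
  imports Defs
begin

text \<open>
  Since \<open>\<sigma> > 0\<close>, the signs of \<open>\<epsilon>\<close> and \<open>\<eta>\<close> agree, so \<open>L t = ln ((\<sigma> t)\<^sup>2)\<close> satisfies the affine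
  recursion \<open>L (t + 1) = c (\<eta> t) * L t + d (\<eta> t)\<close> with \<open>\<bar>c\<bar> \<le> max \<bar>\<alpha>p + \<beta>\<bar> \<bar>\<alpha>m + \<beta>\<bar> < 1\<close> and
  \<open>d (\<eta> t)\<close> integrable. Iterating it and letting the remainder vanish, any stationary \<open>L t\<close> is an
  \<open>L\<^sup>1\<close>-convergent series in \<open>\<eta> s\<close>, \<open>s < t\<close>. Hence \<open>L t\<close> is integrable and independent of \<open>\<eta> t\<close>,
  and both formulas follow by taking expectations in the recursion and in \<open>\<eta> t\<close> times the recursion,
  where symmetry gives each sign half of the mean of an even function of \<open>\<eta> t\<close>.
\<close>

section \<open>Affine recursions and their stationary solutions\<close>

lemma affine_recursion_iterate:
  fixes C D L :: "int \<Rightarrow> real"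
  assumes "\<And>t. L (t + 1) = C t * L t + D t"
  shows "L t = (\<Sum>k<n. (\<Prod>j<k. C (t - 1 - int j)) * D (t - 1 - int k))
               + (\<Prod>j<n. C (t - 1 - int j)) * L (t - int n)"
proof (induction n)
  case (Suc n)
  have "L (t - int n) = C (t - 1 - int n) * L (t - 1 - int n) + D (t - 1 - int n)"
    using assms[of "t - 1 - int n"] by (simp add: algebra_simps)
  moreover have "t - int (Suc n) = t - 1 - int n" by simp
  ultimately show ?case
    using Suc by (simp add: algebra_simps)
qed simp

lemma abs_prod_le_power:
  fixes f :: "nat \<Rightarrow> real"
  assumes "\<And>j. \<bar>f j\<bar> \<le> \<rho>"
  shows "\<bar>\<Prod>j<n. f j\<bar> \<le> \<rho> ^ n"
proof -
  have "\<bar>\<Prod>j<n. f j\<bar> = (\<Prod>j<n. \<bar>f j\<bar>)" by (rule abs_prod)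
  also have "\<dots> \<le> (\<Prod>j<n. \<rho>)" by (rule prod_mono) (use assms in auto)
  finally show ?thesis by simp
qed

lemma integral_cong_distr:
  fixes X Y :: "'a \<Rightarrow> 'b" and f :: "'b \<Rightarrow> real"
  assumes "X \<in> measurable M N" "Y \<in> measurable M N" "f \<in> borel_measurable N"
    and "distr M N X = distr M N Y"
  shows "integrable M (\<lambda>x. f (X x)) \<longleftrightarrow> integrable M (\<lambda>x. f (Y x))"
    and "(\<integral>x. f (X x) \<partial>M) = (\<integral>x. f (Y x) \<partial>M)"
  using integrable_distr_eq[of X M N f] integrable_distr_eq[of Y M N f]
    integral_distr[of X M N f] integral_distr[of Y M N f] assms by auto

context prob_space
begin

text \<open>The \<open>k\<close>-th term has \<open>L^1\<close> norm at most
  \<open>\<rho> ^ k * B\<close>, so the series converges absolutely almost surely and in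
  \<open>L^1\<close>. After \<open>n\<close> steps back, the rest is at most
  \<open>\<rho> ^ n * \<bar>L (t - int n)\<bar>\<close>. Since the law of \<open>L\<close> does not
  change with time, this tends to 0 in probability even before \<open>L\<close> is known to be
  integrable; integrability is then inherited from the series.\<close>

lemma contracting_affine_recursion_series:
  fixes C D L :: "int \<Rightarrow> 'a \<Rightarrow> real"
  assumes [measurable]: "\<And>t. C t \<in> borel_measurable M" "\<And>t. L t \<in> borel_measurable M"
    and \<rho>: "0 \<le> \<rho>" "\<rho> < 1"
    and C: "\<And>t. AE x in M. \<bar>C t x\<bar> \<le> \<rho>"
    and rec: "\<And>t. AE x in M. L (t + 1) x = C t x * L t x + D t x"
    and law: "\<And>t. distr M borel (L t) = distr M borel (L 0)"
    and D: "\<And>t. integrable M (D t)" "\<And>t. (\<integral>x. \<bar>D t x\<bar> \<partial>M) \<le> B"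
  shows "integrable M (L t)"
    and "AE x in M. L t x = (\<Sum>k. (\<Prod>j<k. C (t - 1 - int j) x) * D (t - 1 - int k) x)"
proof -
  define f where "f k x = (\<Prod>j<k. C (t - 1 - int j) x) * D (t - 1 - int k) x" for k x
  have [measurable]: "D t \<in> borel_measurable M" for t using D(1) by auto
  have [measurable]: "f k \<in> borel_measurable M" for k unfolding f_def by measurable
  \<comment> \<open>There are countably many times, so one null set serves all of them and the
    iteration can be carried out path by path.\<close>
  have C': "AE x in M. \<forall>t. \<bar>C t x\<bar> \<le> \<rho>" using C by (simp add: AE_all_countable)
  have rec': "AE x in M. \<forall>t. L (t + 1) x = C t x * L t x + D t x"
    using rec by (simp add: AE_all_countable)
  have f_le: "AE x in M. \<bar>f k x\<bar> \<le> \<rho> ^ k * \<bar>D (t - 1 - int k) x\<bar>" for k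
    using C'
  proof eventually_elim
    case (elim x)
    then have "\<bar>\<Prod>j<k. C (t - 1 - int j) x\<bar> \<le> \<rho> ^ k"
      by (intro abs_prod_le_power) auto
    then show ?case by (simp add: f_def abs_mult mult_right_mono)
  qed
  have f_int: "integrable M (f k)" for k
    by (rule Bochner_Integration.integrable_bound[of _ "\<lambda>x. \<rho> ^ k * \<bar>D (t - 1 - int k) x\<bar>"])
       (use f_le[of k] D \<rho> in \<open>auto simp: abs_mult\<close>)
  have f_bound: "(\<integral>x. norm (f k x) \<partial>M) \<le> \<rho> ^ k * B" for k
  proof -
    have "(\<integral>x. norm (f k x) \<partial>M) \<le> (\<integral>x. \<rho> ^ k * \<bar>D (t - 1 - int k) x\<bar> \<partial>M)"
      by (rule integral_mono_AE) (use f_le[of k] f_int D in auto)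
    also have "\<dots> \<le> \<rho> ^ k * B"
      using D \<rho> by (auto intro: mult_left_mono)
    finally show ?thesis .
  qed
  have f_sum: "summable (\<lambda>k. \<integral>x. norm (f k x) \<partial>M)"
    by (rule summable_comparison_test'[of "\<lambda>k. \<rho> ^ k * B" 0])
       (use f_bound \<rho> in \<open>auto intro: summable_mult2 summable_geometric\<close>)
  have f_AE: "AE x in M. summable (\<lambda>k. norm (f k x))"
  proof -
    \<comment> \<open>By Tonelli, summable \<open>L^1\<close> norms force the sum of absolute values
      to be finite almost everywhere.\<close>
    have "(\<integral>\<^sup>+x. (\<Sum>k. ennreal (norm (f k x))) \<partial>M) = (\<Sum>k. \<integral>\<^sup>+x. ennreal (norm (f k x)) \<partial>M)"
      by (rule nn_integral_suminf) auto
    also have "\<dots> = (\<Sum>k. ennreal (\<integral>x. norm (f k x) \<partial>M))"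
      using f_int by (subst nn_integral_eq_integral) auto
    also have "\<dots> \<noteq> \<infinity>"
      unfolding infinity_ennreal_def by (rule ennreal_suminf_neq_top[OF f_sum]) simp
    finally have "AE x in M. (\<Sum>k. ennreal (norm (f k x))) \<noteq> \<infinity>"
      by (intro nn_integral_PInf_AE) auto
    then show ?thesis
      by eventually_elim (auto intro: summable_suminf_not_top)
  qed
  define S where "S x = (\<Sum>k. f k x)" for x
  have [measurable]: "S \<in> borel_measurable M" unfolding S_def by measurable
  have S_int: "integrable M S"
    unfolding S_def by (rule integrable_suminf) (use f_int f_AE f_sum in auto)
  have lim: "AE x in M. (\<lambda>n. \<Sum>k<n. f k x) \<longlonglongrightarrow> S x"
    using f_AE
    by eventually_elim (auto simp: S_def intro!: summable_LIMSEQ dest: summable_rabs_cancel)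
  \<comment> \<open>Integrability of \<open>L t\<close> is still open here. Truncating at 1 allows
    dominated convergence and loses nothing, since \<open>V x = 0\<close> exactly when
    \<open>L t x = S x\<close>.\<close>
  define R where "R n x = min 1 \<bar>L t x - (\<Sum>k<n. f k x)\<bar>" for n x
  define V where "V x = min 1 \<bar>L t x - S x\<bar>" for x
  have [measurable]: "R n \<in> borel_measurable M" "V \<in> borel_measurable M" for n
    unfolding R_def V_def by measurable
  have R_int: "(\<lambda>n. \<integral>x. R n x \<partial>M) \<longlonglongrightarrow> (\<integral>x. V x \<partial>M)"
  proof (rule integral_dominated_convergence[where w = "\<lambda>_. 1"])
    show "AE x in M. (\<lambda>n. R n x) \<longlonglongrightarrow> V x"
      using lim by eventually_elim (auto simp: R_def V_def intro!: tendsto_intros)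
  qed (auto simp: R_def)
  \<comment> \<open>Stationarity replaces \<open>L (t - n)\<close> by \<open>L 0\<close> in the remainder, which makes it small in mean.\<close>
  have "(\<lambda>n. \<integral>x. min 1 (\<rho> ^ n * \<bar>L 0 x\<bar>) \<partial>M) \<longlonglongrightarrow> (\<integral>x. 0 \<partial>M)"
  proof (rule integral_dominated_convergence[where w = "\<lambda>_. 1"])
    have "(\<lambda>n. min 1 (\<rho> ^ n * y)) \<longlonglongrightarrow> min 1 (0 * y)" for y
      using \<rho> by (intro tendsto_intros LIMSEQ_realpow_zero) auto
    then show "AE x in M. (\<lambda>n. min 1 (\<rho> ^ n * \<bar>L 0 x\<bar>)) \<longlonglongrightarrow> 0" by simp
  qed (use \<rho> in auto)
  moreover have "(\<integral>x. R n x \<partial>M) \<le> (\<integral>x. min 1 (\<rho> ^ n * \<bar>L 0 x\<bar>) \<partial>M)" for n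
  proof -
    have "(\<integral>x. R n x \<partial>M) \<le> (\<integral>x. min 1 (\<rho> ^ n * \<bar>L (t - int n) x\<bar>) \<partial>M)"
    proof (rule integral_mono_AE)
      show "integrable M (R n)"
        by (rule integrable_const_bound[of _ 1]) (auto simp: R_def)
      show "integrable M (\<lambda>x. min 1 (\<rho> ^ n * \<bar>L (t - int n) x\<bar>))"
        by (rule integrable_const_bound[of _ 1]) (use \<rho> in auto)
      show "AE x in M. R n x \<le> min 1 (\<rho> ^ n * \<bar>L (t - int n) x\<bar>)"
        using C' rec'
      proof eventually_elim
        case (elim x)
        have "L t x - (\<Sum>k<n. f k x) = (\<Prod>j<n. C (t - 1 - int j) x) * L (t - int n) x"
          using affine_recursion_iterate[of "\<lambda>t. L t x" "\<lambda>t. C t x" "\<lambda>t. D t x" t n] elim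
          by (simp add: f_def)
        moreover have "\<bar>\<Prod>j<n. C (t - 1 - int j) x\<bar> \<le> \<rho> ^ n"
          using elim by (intro abs_prod_le_power) auto
        ultimately have "\<bar>L t x - (\<Sum>k<n. f k x)\<bar> \<le> \<rho> ^ n * \<bar>L (t - int n) x\<bar>"
          by (simp add: abs_mult mult_right_mono)
        then show ?case unfolding R_def by linarith
      qed
    qed
    also have "\<dots> = (\<integral>x. min 1 (\<rho> ^ n * \<bar>L 0 x\<bar>) \<partial>M)"
      by (rule integral_cong_distr(2)[where f = "\<lambda>y. min 1 (\<rho> ^ n * \<bar>y\<bar>)", OF _ _ _ law]) auto
    finally show ?thesis .
  qed
  ultimately have "(\<integral>x. V x \<partial>M) \<le> 0"
    using LIMSEQ_le[OF R_int] by fastforce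
  moreover have V_nonneg: "0 \<le> V x" for x by (simp add: V_def)
  moreover have "integrable M V"
    by (rule integrable_const_bound[of _ 1]) (auto simp: V_def)
  ultimately have "AE x in M. V x = 0"
    by (subst integral_nonneg_eq_0_iff_AE[symmetric])
       (auto intro: antisym Bochner_Integration.integral_nonneg)
  then have L_eq: "AE x in M. L t x = S x"
    by eventually_elim (auto simp: V_def min_def split: if_splits)
  then show "AE x in M. L t x = (\<Sum>k. (\<Prod>j<k. C (t - 1 - int j) x) * D (t - 1 - int k) x)"
    by (simp add: S_def f_def)
  show "integrable M (L t)"
    by (rule integrable_cong_AE_imp[OF S_int]) (use L_eq in auto)
qed

section \<open>Symmetric laws and moment conditions\<close>

text \<open>Replacing \<open>X\<close> by \<open>- X\<close> swaps the contributions of the two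
  half-lines; as \<open>X\<close> is almost surely nonzero, each is half of the whole. The free
  weights \<open>p\<close> and \<open>m\<close> serve both the mean, with \<open>\<alpha>p\<close>
  and \<open>\<alpha>m\<close>, and the covariance, where the second weight changes sign.\<close>

lemma integral_sign_weighted_symmetric:
  fixes X :: "'a \<Rightarrow> real" and g :: "real \<Rightarrow> real" and p m :: real
  assumes [measurable]: "X \<in> borel_measurable M" "g \<in> borel_measurable borel"
    and sym: "symmetrically_distributed M X"
    and nz: "AE x in M. X x \<noteq> 0"
    and even: "\<And>y. g (- y) = g y"
    and int: "integrable M (\<lambda>x. g (X x))"
  shows "integrable M (\<lambda>x. (p * of_bool (X x > 0) + m * of_bool (X x < 0)) * g (X x))"
    and "(\<integral>x. (p * of_bool (X x > 0) + m * of_bool (X x < 0)) * g (X x) \<partial>M)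
         = 1/2 * (p + m) * (\<integral>x. g (X x) \<partial>M)"
proof -
  define P N where "P x = of_bool (X x > 0) * g (X x)" and "N x = of_bool (X x < 0) * g (X x)" for x
  have [measurable]: "P \<in> borel_measurable M" "N \<in> borel_measurable M"
    unfolding P_def N_def by measurable
  have PN_int: "integrable M P" "integrable M N"
    by (rule Bochner_Integration.integrable_bound[OF int]; simp add: P_def N_def)+
  have "(\<integral>x. P x \<partial>M) = (\<integral>x. N x \<partial>M)"
    using integral_cong_distr(2)[where f = "\<lambda>y. of_bool (y > 0) * g y" and X = "\<lambda>x. - X x" and Y = X
      and M = M and N = borel] sym
    by (simp add: symmetrically_distributed_def even P_def N_def)
  moreover have "(\<integral>x. g (X x) \<partial>M) = (\<integral>x. P x + N x \<partial>M)"
    by (rule integral_cong_AE) (use nz in \<open>auto simp: P_def N_def\<close>)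
  moreover have eq: "(p * of_bool (X x > 0) + m * of_bool (X x < 0)) * g (X x) = p * P x + m * N x" for x
    by (simp add: P_def N_def algebra_simps)
  ultimately show
    "(\<integral>x. (p * of_bool (X x > 0) + m * of_bool (X x < 0)) * g (X x) \<partial>M)
     = 1/2 * (p + m) * (\<integral>x. g (X x) \<partial>M)"
    using PN_int by (simp add: algebra_simps)
  show "integrable M (\<lambda>x. (p * of_bool (X x > 0) + m * of_bool (X x < 0)) * g (X x))"
    unfolding eq using PN_int by simp
qed

text \<open>The integrand is infinite on \<open>X = 0\<close>, so a finite integral makes that event
  null. Elsewhere \<open>ln (y\<^sup>2) = 2 * ln \<bar>y\<bar>\<close>.\<close>

lemma finite_log_second_momentD:
  assumes [measurable]: "X \<in> borel_measurable M" and fin: "finite_log_second_moment M X"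
  shows "AE x in M. X x \<noteq> 0"
    and "integrable M (\<lambda>x. (ln ((X x)\<^sup>2))\<^sup>2)"
proof -
  define h where "h y = e2ennreal (\<bar>log_abs y\<bar>\<^sup>2)" for y
  have h_eq: "h y = (if y = 0 then \<infinity> else ennreal ((ln \<bar>y\<bar>)\<^sup>2))" for y
    by (simp add: h_def log_abs_def power2_eq_square e2ennreal_ereal flip: abs_mult)
  have [measurable]: "h \<in> borel_measurable borel" unfolding h_eq[abs_def] by measurable
  have fin': "(\<integral>\<^sup>+x. h (X x) \<partial>M) < \<infinity>"
    using fin by (simp add: finite_log_second_moment_def h_def)
  then have "AE x in M. h (X x) \<noteq> \<infinity>"
    by (intro nn_integral_PInf_AE) auto
  then show nz: "AE x in M. X x \<noteq> 0"
    by eventually_elim (auto simp: h_eq)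
  have "integrable M (\<lambda>x. (ln \<bar>X x\<bar>)\<^sup>2)"
  proof (rule integrableI_bounded)
    have "(\<integral>\<^sup>+x. ennreal (norm ((ln \<bar>X x\<bar>)\<^sup>2)) \<partial>M) = (\<integral>\<^sup>+x. h (X x) \<partial>M)"
      by (rule nn_integral_cong_AE) (use nz in \<open>auto simp: h_eq\<close>)
    then show "(\<integral>\<^sup>+x. ennreal (norm ((ln \<bar>X x\<bar>)\<^sup>2)) \<partial>M) < \<infinity>" using fin' by simp
  qed auto
  then have "integrable M (\<lambda>x. 4 * (ln \<bar>X x\<bar>)\<^sup>2)" by simp
  \<comment> \<open>The identity holds at \<open>y = 0\<close> too, where \<open>ln 0 = 0\<close>
    makes both sides vanish.\<close>
  moreover have "(ln (y\<^sup>2))\<^sup>2 = 4 * (ln \<bar>y\<bar>)\<^sup>2" for y :: real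
    using ln_realpow[of "\<bar>y\<bar>" 2] by (cases "y = 0") (auto simp: power_mult_distrib)
  ultimately show "integrable M (\<lambda>x. (ln ((X x)\<^sup>2))\<^sup>2)" by simp
qed

lemma integrable_mult_square_integrable:
  fixes X Y :: "'a \<Rightarrow> real"
  assumes [measurable]: "X \<in> borel_measurable M" "Y \<in> borel_measurable M"
    and "integrable M (\<lambda>x. (X x)\<^sup>2)" "integrable M (\<lambda>x. (Y x)\<^sup>2)"
  shows "integrable M (\<lambda>x. X x * Y x)"
proof (rule Bochner_Integration.integrable_bound)
  show "integrable M (\<lambda>x. (X x)\<^sup>2 + (Y x)\<^sup>2)" using assms by simp
  have "\<bar>a * b\<bar> \<le> a\<^sup>2 + b\<^sup>2" for a b :: real
  proof -
    have "2 * (\<bar>a\<bar> * \<bar>b\<bar>) \<le> a\<^sup>2 + b\<^sup>2"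
      using sum_squares_bound[of "\<bar>a\<bar>" "\<bar>b\<bar>"] by simp
    moreover have "0 \<le> \<bar>a\<bar> * \<bar>b\<bar>" by simp
    ultimately show ?thesis unfolding abs_mult by linarith
  qed
  then show "AE x in M. norm (X x * Y x) \<le> norm ((X x)\<^sup>2 + (Y x)\<^sup>2)" by simp
qed simp

section \<open>Stationary marginals and independence of the past\<close>

text \<open>This is shift invariance for the single index set \<open>{0}\<close>, pushed forward
  along \<open>f\<close> of the only coordinate.\<close>

lemma strictly_stationary_distr_eq:
  assumes stat: "strictly_stationary M N X" and [measurable]: "f \<in> measurable N K"
  shows "distr M K (\<lambda>x. f (X t x)) = distr M K (\<lambda>x. f (X 0 x))"
proof -
  have [measurable]: "X t \<in> measurable M N" for t
    using stat by (simp add: strictly_stationary_def)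
  have joint: "distr M (Pi\<^sub>M {0} (\<lambda>_. N)) (\<lambda>x. \<lambda>s\<in>{0}. X (s + t) x)
    = distr M (Pi\<^sub>M {0} (\<lambda>_. N)) (\<lambda>x. \<lambda>s\<in>{0}. X s x)"
    using stat unfolding strictly_stationary_def by blast
  have "distr (distr M (Pi\<^sub>M {0} (\<lambda>_. N)) (\<lambda>x. \<lambda>s\<in>{0}. X (s + h) x)) K (\<lambda>y. f (y 0))
    = distr M K (\<lambda>x. f (X h x))" for h
    by (subst distr_distr) (simp_all add: comp_def)
  from this[of t] this[of 0] joint show ?thesis by simp
qed

text \<open>The index blocks \<open>{t}\<close> and \<open>{..<t}\<close> are disjoint, so
  \<open>h (\<eta> t)\<close> is independent of any measurable function of the past. As
  \<open>L\<close> is such a function only almost surely, the product rule is applied to an exact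
  version \<open>S\<close> and carried back.\<close>

lemma integral_mult_function_of_past:
  fixes \<eta> :: "int \<Rightarrow> 'a \<Rightarrow> real" and h :: "real \<Rightarrow> real" and g :: "(int \<Rightarrow> real) \<Rightarrow> real"
  assumes ind: "indep_vars (\<lambda>_. borel) \<eta> UNIV"
    and [measurable]: "h \<in> borel_measurable borel" "g \<in> borel_measurable (Pi\<^sub>M {..<t} (\<lambda>_. borel))"
      "L \<in> borel_measurable M"
    and L: "AE x in M. L x = g (\<lambda>s\<in>{..<t}. \<eta> s x)"
    and int: "integrable M (\<lambda>x. h (\<eta> t x))" "integrable M L"
  shows "integrable M (\<lambda>x. h (\<eta> t x) * L x)"
    and "(\<integral>x. h (\<eta> t x) * L x \<partial>M) = (\<integral>x. h (\<eta> t x) \<partial>M) * (\<integral>x. L x \<partial>M)"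
proof -
  have [measurable]: "\<eta> s \<in> borel_measurable M" for s
    using ind by (auto simp: indep_vars_def)
  define S where "S x = g (\<lambda>s\<in>{..<t}. \<eta> s x)" for x
  have [measurable]: "S \<in> borel_measurable M" unfolding S_def by measurable
  have "indep_var (Pi\<^sub>M {t} (\<lambda>_. borel)) (\<lambda>x. \<lambda>s\<in>{t}. \<eta> s x)
          (Pi\<^sub>M {..<t} (\<lambda>_. borel)) (\<lambda>x. \<lambda>s\<in>{..<t}. \<eta> s x)"
    by (rule indep_var_restrict[OF ind]) auto
  from indep_var_compose[OF this, of "\<lambda>y. h (y t)" borel g borel]
  have ind': "indep_var borel (\<lambda>x. h (\<eta> t x)) borel S"
    by (simp add: comp_def S_def[abs_def])
  have S_int: "integrable M S"
    by (rule integrable_cong_AE_imp[OF int(2)]) (use L in \<open>auto simp: S_def\<close>)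
  have eq: "AE x in M. h (\<eta> t x) * L x = h (\<eta> t x) * S x"
    using L by eventually_elim (simp add: S_def)
  show "integrable M (\<lambda>x. h (\<eta> t x) * L x)"
    by (rule integrable_cong_AE_imp[OF indep_var_integrable[OF ind' int(1) S_int]])
       (use eq in auto)
  have "(\<integral>x. h (\<eta> t x) * L x \<partial>M) = (\<integral>x. h (\<eta> t x) * S x \<partial>M)"
    by (rule integral_cong_AE) (use eq in auto)
  also have "\<dots> = (\<integral>x. h (\<eta> t x) \<partial>M) * (\<integral>x. S x \<partial>M)"
    by (rule indep_var_lebesgue_integral[OF ind' int(1) S_int])
  also have "(\<integral>x. S x \<partial>M) = (\<integral>x. L x \<partial>M)"
    by (rule integral_cong_AE) (use L in \<open>auto simp: S_def\<close>)
  finally show "(\<integral>x. h (\<eta> t x) * L x \<partial>M) = (\<integral>x. h (\<eta> t x) \<partial>M) * (\<integral>x. L x \<partial>M)" .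
qed

end

section \<open>The asymmetric log-GARCH model\<close>

theorem proposition2p4:
  fixes M :: "'a measure"
    and \<eta> \<epsilon> \<sigma> :: "int \<Rightarrow> 'a \<Rightarrow> real"
    and \<omega> \<alpha>p \<alpha>m \<beta> :: real
  assumes "prob_space M"
    and "iid_process M borel \<eta>"
    and "integrable M (\<eta> 0)" and "(\<integral>x. \<eta> 0 x \<partial>M) = 0"
    and "integrable M (\<lambda>x. (\<eta> 0 x)\<^sup>2)" and "(\<integral>x. (\<eta> 0 x)\<^sup>2 \<partial>M) = 1"
    and "max \<bar>\<alpha>p + \<beta>\<bar> \<bar>\<alpha>m + \<beta>\<bar> < 1"
    and "symmetrically_distributed M (\<eta> 0)"
    and "finite_log_second_moment M (\<eta> 0)"
    and "\<bar>\<beta>\<bar> + 1/2 * (\<bar>\<alpha>p\<bar> + \<bar>\<alpha>m\<bar>) < 1"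
    and "strictly_stationary_solution M \<eta> \<omega> \<alpha>p \<alpha>m \<beta> \<epsilon> \<sigma>"
  shows "integrable M (\<lambda>x. ln ((\<eta> 0 x)\<^sup>2)) \<and>
    integrable M (\<lambda>x. \<bar>\<eta> 0 x\<bar> * ln ((\<eta> 0 x)\<^sup>2)) \<and>
    (\<forall>t. integrable M (\<lambda>x. ln ((\<sigma> t x)\<^sup>2)) \<and>
         integrable M (\<lambda>x. \<eta> (t - 1) x * ln ((\<sigma> t x)\<^sup>2)) \<and>
         (let \<tau> = (\<integral>x. ln ((\<sigma> t x)\<^sup>2) \<partial>M) in
            \<tau> = (\<omega> + 1/2 * (\<alpha>p + \<alpha>m) * (\<integral>x. ln ((\<eta> 0 x)\<^sup>2) \<partial>M))
                  / (1 - \<beta> - 1/2 * (\<alpha>p + \<alpha>m)) \<and>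
            covariance M (\<eta> (t - 1)) (\<lambda>x. ln ((\<sigma> t x)\<^sup>2)) =
              1/2 * (\<alpha>p - \<alpha>m) *
                ((\<integral>x. \<bar>\<eta> 0 x\<bar> \<partial>M) * \<tau> + (\<integral>x. \<bar>\<eta> 0 x\<bar> * ln ((\<eta> 0 x)\<^sup>2) \<partial>M))))"
proof -
  interpret prob_space M by fact
  have ind: "indep_vars (\<lambda>_. borel) \<eta> UNIV" and law: "distr M borel (\<eta> t) = distr M borel (\<eta> 0)" for t
    using assms(2) by (auto simp: iid_process_def)
  have \<eta>_meas[measurable]: "\<eta> t \<in> borel_measurable M" for t
    using ind by (auto simp: indep_vars_def)
  have garch: "asym_log_garch M \<eta> \<omega> \<alpha>p \<alpha>m \<beta> \<epsilon> \<sigma>"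
    and stat: "strictly_stationary M borel (\<lambda>t x. (\<epsilon> t x, \<sigma> t x))"
    using assms(11) by (simp_all add: strictly_stationary_solution_def)
  have [measurable]: "\<sigma> t \<in> borel_measurable M" for t
    using garch by (simp add: asym_log_garch_def)
  note log_moment = finite_log_second_momentD[OF \<eta>_meas assms(9)]
  have transfer: "integrable M (\<lambda>x. f (\<eta> t x)) \<longleftrightarrow> integrable M (\<lambda>x. f (\<eta> 0 x))"
      "(\<integral>x. f (\<eta> t x) \<partial>M) = (\<integral>x. f (\<eta> 0 x) \<partial>M)"
    if "f \<in> borel_measurable borel" for f :: "real \<Rightarrow> real" and t
    using integral_cong_distr[OF _ _ that law[of t]] by auto
  have nz: "AE x in M. \<eta> t x \<noteq> 0" for t
  proof -
    \<comment> \<open>Being nonzero almost surely depends on the law only, so it passes from time 0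
      to every time.\<close>
    have "AE y in distr M borel (\<eta> 0). y \<noteq> 0"
      using log_moment(1) by (subst AE_distr_iff) auto
    then have "AE y in distr M borel (\<eta> t). y \<noteq> 0" by (subst law)
    then show ?thesis by (subst (asm) AE_distr_iff) auto
  qed

  \<comment> \<open>Moments of functions of one innovation\<close>
  define w where "w p m y = p * of_bool (y > 0) + m * of_bool (y < 0)" for p m y :: real
  define a where "a = w \<alpha>p \<alpha>m"
  define Z where "Z y = ln (y\<^sup>2)" for y :: real
  define L where "L t x = ln ((\<sigma> t x)\<^sup>2)" for t x
  have [measurable]: "w p m \<in> borel_measurable borel" for p m
    unfolding w_def by measurable
  have [measurable]: "a \<in> borel_measurable borel" "Z \<in> borel_measurable borel"
      "L t \<in> borel_measurable M" for t
    unfolding a_def Z_def L_def by measurable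
  have Z_int: "integrable M (\<lambda>x. Z (\<eta> 0 x))"
    using square_integrable_imp_integrable[of "\<lambda>x. Z (\<eta> 0 x)"] log_moment(2) by (simp add: Z_def)
  have absZ_int: "integrable M (\<lambda>x. \<bar>\<eta> 0 x\<bar> * Z (\<eta> 0 x))"
    by (rule integrable_mult_square_integrable) (use assms(5) log_moment(2) in \<open>auto simp: Z_def\<close>)
  have weight: "integrable M (\<lambda>x. w p m (\<eta> t x) * g (\<eta> t x))"
      "(\<integral>x. w p m (\<eta> t x) * g (\<eta> t x) \<partial>M) = 1/2 * (p + m) * (\<integral>x. g (\<eta> 0 x) \<partial>M)"
    if [measurable]: "g \<in> borel_measurable borel" and "\<And>y. g (- y) = g y"
      "integrable M (\<lambda>x. g (\<eta> 0 x))" for g :: "real \<Rightarrow> real" and p m t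
  proof -
    note sym = integral_sign_weighted_symmetric[where X = "\<eta> 0" and g = g and p = p and m = m,
        OF \<eta>_meas that(1) assms(8) log_moment(1) that(2,3), folded w_def]
    have wg: "(\<lambda>y. w p m y * g y) \<in> borel_measurable borel" by measurable
    show "integrable M (\<lambda>x. w p m (\<eta> t x) * g (\<eta> t x))"
      using sym(1) transfer(1)[OF wg, of t] by blast
    show "(\<integral>x. w p m (\<eta> t x) * g (\<eta> t x) \<partial>M) = 1/2 * (p + m) * (\<integral>x. g (\<eta> 0 x) \<partial>M)"
      using sym(2) transfer(2)[OF wg, of t] by (rule trans[rotated])
  qed
  have a1: "integrable M (\<lambda>x. a (\<eta> t x))" "(\<integral>x. a (\<eta> t x) \<partial>M) = 1/2 * (\<alpha>p + \<alpha>m)" for t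
    using weight[of "\<lambda>_. 1" \<alpha>p \<alpha>m t, OF borel_measurable_const refl integrable_const]
    by (simp_all add: a_def prob_space)
  have Z_even: "Z (- y) = Z y" for y by (simp add: Z_def)
  have aZ: "integrable M (\<lambda>x. a (\<eta> t x) * Z (\<eta> t x))"
      "(\<integral>x. a (\<eta> t x) * Z (\<eta> t x) \<partial>M) = 1/2 * (\<alpha>p + \<alpha>m) * (\<integral>x. Z (\<eta> 0 x) \<partial>M)" for t
    unfolding a_def by (rule weight; use Z_even Z_int in simp)+
  \<comment> \<open>Writing \<open>y\<close> as its sign times \<open>\<bar>y\<bar>\<close> flips
    the weight on the negative half-line. This is the source of \<open>\<alpha>p - \<alpha>m\<close>
    in the covariance, as opposed to \<open>\<alpha>p + \<alpha>m\<close> in the mean.\<close>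
  have signed: "y * a y = w \<alpha>p (- \<alpha>m) y * \<bar>y\<bar>" for y
    by (simp add: a_def w_def)
  have \<eta>a: "integrable M (\<lambda>x. \<eta> t x * a (\<eta> t x))"
      "(\<integral>x. \<eta> t x * a (\<eta> t x) \<partial>M) = 1/2 * (\<alpha>p - \<alpha>m) * (\<integral>x. \<bar>\<eta> 0 x\<bar> \<partial>M)" for t
    using weight[of abs \<alpha>p "- \<alpha>m" t, OF borel_measurable_abs[OF measurable_ident_sets[OF refl]]
        abs_minus_cancel integrable_abs[OF assms(3)]]
    by (simp_all only: signed diff_conv_add_uminus)
  have absZ_meas: "(\<lambda>y. \<bar>y\<bar> * Z y) \<in> borel_measurable borel" by measurable
  have \<eta>aZ: "integrable M (\<lambda>x. \<eta> t x * a (\<eta> t x) * Z (\<eta> t x))"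
      "(\<integral>x. \<eta> t x * a (\<eta> t x) * Z (\<eta> t x) \<partial>M)
       = 1/2 * (\<alpha>p - \<alpha>m) * (\<integral>x. \<bar>\<eta> 0 x\<bar> * Z (\<eta> 0 x) \<partial>M)" for t
    using weight[of "\<lambda>y. \<bar>y\<bar> * Z y" \<alpha>p "- \<alpha>m" t, OF absZ_meas _ absZ_int]
    by (simp_all only: signed Z_even abs_minus_cancel mult.assoc diff_conv_add_uminus)
  have \<eta>_int: "integrable M (\<eta> t)" "(\<integral>x. \<eta> t x \<partial>M) = 0" for t
    using transfer[of "\<lambda>y. y" t] assms(3,4) by simp_all

  \<comment> \<open>The recursion for the log-volatility and its solution\<close>
  define \<rho> where "\<rho> = max \<bar>\<alpha>p + \<beta>\<bar> \<bar>\<alpha>m + \<beta>\<bar>"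
  have \<rho>: "0 \<le> \<rho>" "\<rho> < 1" using assms(7) by (auto simp: \<rho>_def)
  \<comment> \<open>With \<open>ln (\<epsilon>\<^sup>2) = L + Z \<eta>\<close>, the coefficient
    \<open>a\<close> multiplies both \<open>L\<close> and \<open>Z\<close>; \<open>c\<close>
    collects the factors of \<open>L\<close> and \<open>d\<close> the rest.\<close>
  define c where "c y = a y + \<beta>" for y
  define d where "d y = \<omega> + a y * Z y" for y
  have [measurable]: "c \<in> borel_measurable borel" "d \<in> borel_measurable borel"
    unfolding c_def d_def by measurable
  have rec: "AE x in M. L (t + 1) x = c (\<eta> t x) * L t x + d (\<eta> t x)" for t
  proof -
    have "AE x in M. \<sigma> t x > 0 \<and> \<epsilon> t x = \<sigma> t x * \<eta> t x"
      using garch unfolding asym_log_garch_def by fast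
    moreover have "AE x in M. L (t + 1) x = \<omega> + a (\<epsilon> t x) * Z (\<epsilon> t x) + \<beta> * L t x"
      using garch unfolding asym_log_garch_def L_def a_def w_def Z_def
      by (auto dest: spec[of _ "t + 1"])
    ultimately show ?thesis using nz[of t]
    proof eventually_elim
      case (elim x)
      then have "Z (\<epsilon> t x) = L t x + Z (\<eta> t x)"
        by (simp add: Z_def L_def power_mult_distrib ln_mult)
      moreover have "a (\<epsilon> t x) = a (\<eta> t x)"
        using elim by (simp add: a_def w_def zero_less_mult_iff mult_less_0_iff)
      ultimately show ?case using elim by (simp add: c_def d_def algebra_simps)
    qed
  qed
  have d_int: "integrable M (\<lambda>x. d (\<eta> t x))" for t
    unfolding d_def using aZ(1) by simp
  have d_abs: "(\<integral>x. \<bar>d (\<eta> t x)\<bar> \<partial>M) \<le> (\<integral>x. \<bar>d (\<eta> 0 x)\<bar> \<partial>M)" for t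
    using transfer(2)[of "\<lambda>y. \<bar>d y\<bar>" t] by simp
  have c_bound: "AE x in M. \<bar>c (\<eta> t x)\<bar> \<le> \<rho>" for t
    \<comment> \<open>The values of \<open>c\<close> are \<open>\<alpha>p + \<beta>\<close> and
      \<open>\<alpha>m + \<beta>\<close>, apart from \<open>c 0 = \<beta>\<close>, which occurs with
      probability 0.\<close>
    using nz[of t] by eventually_elim (auto simp: c_def a_def w_def \<rho>_def)
  have L_law: "distr M borel (L t) = distr M borel (L 0)" for t
  proof -
    \<comment> \<open>Stationarity is stated for the Borel sets of the plane, so measurability of
      the projection comes from continuity.\<close>
    have "snd \<in> borel_measurable (borel :: (real \<times> real) measure)"
      by (intro borel_measurable_continuous_onI continuous_intros)
    then have "(\<lambda>z. ln ((snd z)\<^sup>2)) \<in> borel_measurable (borel :: (real \<times> real) measure)"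
      by measurable
    from strictly_stationary_distr_eq[OF stat this, of t] show ?thesis
      by (simp add: L_def[abs_def])
  qed
  note series = contracting_affine_recursion_series[where C = "\<lambda>t x. c (\<eta> t x)" and L = L
      and D = "\<lambda>t x. d (\<eta> t x)", OF _ _ \<rho> c_bound rec L_law d_int d_abs]
  have L_int: "integrable M (L t)" for t by (rule series(1)) measurable
  define g where "g t y = (\<Sum>k. (\<Prod>j<k. c (y (t - 1 - int j))) * d (y (t - 1 - int k)))"
    for t and y :: "int \<Rightarrow> real"
  have g_meas: "g t \<in> borel_measurable (Pi\<^sub>M {..<t} (\<lambda>_. borel))" for t
  proof -
    have [measurable]: "(\<lambda>y. y (t - 1 - int k)) \<in> borel_measurable (Pi\<^sub>M {..<t} (\<lambda>_. borel))" for k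
      by (rule measurable_component_singleton) simp
    show ?thesis unfolding g_def by measurable
  qed
  \<comment> \<open>All indices \<open>t - 1 - int k\<close> read by \<open>g t\<close> lie below
    \<open>t\<close>, so restricting the path to \<open>{..<t}\<close> leaves the series
    unchanged.\<close>
  have L_past: "AE x in M. L t x = g t (\<lambda>s\<in>{..<t}. \<eta> s x)" for t
    using series(2)[of t] by (simp add: g_def)
  have past: "integrable M (\<lambda>x. h (\<eta> t x) * L t x)"
      "(\<integral>x. h (\<eta> t x) * L t x \<partial>M) = (\<integral>x. h (\<eta> t x) \<partial>M) * (\<integral>x. L t x \<partial>M)"
    if "h \<in> borel_measurable borel" "integrable M (\<lambda>x. h (\<eta> t x))" for h :: "real \<Rightarrow> real" and t
    by (rule integral_mult_function_of_past[where h = h and g = "g t" and L = "L t" and t = t,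
        OF ind that(1) g_meas _ L_past that(2) L_int]; measurable)+
  define \<tau> where "\<tau> = (\<integral>x. L 0 x \<partial>M)"
  have L_mean: "(\<integral>x. L t x \<partial>M) = \<tau>" for t
    unfolding \<tau>_def by (rule integral_cong_distr(2)[where f = "\<lambda>y. y", OF _ _ _ L_law]) auto

  \<comment> \<open>The mean\<close>
  have \<tau>_eq: "\<tau> = (\<omega> + 1/2 * (\<alpha>p + \<alpha>m) * (\<integral>x. Z (\<eta> 0 x) \<partial>M)) / (1 - \<beta> - 1/2 * (\<alpha>p + \<alpha>m))"
  proof -
    \<comment> \<open>Both sides of the recursion have the same mean \<open>\<tau>\<close> of
      \<open>L\<close>, and \<open>L 0\<close> is independent of \<open>\<eta> 0\<close>; this gives
      a linear equation for \<open>\<tau>\<close>.\<close>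
    have "\<tau> = (\<integral>x. L (0 + 1) x \<partial>M)" by (simp only: L_mean)
    also have "\<dots> = (\<integral>x. a (\<eta> 0 x) * L 0 x + \<beta> * L 0 x + (\<omega> + a (\<eta> 0 x) * Z (\<eta> 0 x)) \<partial>M)"
      by (rule integral_cong_AE) (use rec[of 0] in \<open>auto simp: c_def d_def algebra_simps\<close>)
    also have "\<dots> = 1/2 * (\<alpha>p + \<alpha>m) * \<tau> + \<beta> * \<tau> + (\<omega> + 1/2 * (\<alpha>p + \<alpha>m) * (\<integral>x. Z (\<eta> 0 x) \<partial>M))"
      using past[of a 0] a1[of 0] aZ[of 0] L_int[of 0] by (simp add: L_mean prob_space)
    finally have "\<tau> * (1 - \<beta> - 1/2 * (\<alpha>p + \<alpha>m)) = \<omega> + 1/2 * (\<alpha>p + \<alpha>m) * (\<integral>x. Z (\<eta> 0 x) \<partial>M)"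
      by (simp add: algebra_simps)
    \<comment> \<open>The bound on \<open>\<bar>\<beta>\<bar> + 1/2 * (\<bar>\<alpha>p\<bar> +
      \<bar>\<alpha>m\<bar>)\<close> makes the linear equation solvable.\<close>
    moreover have "0 < 1 - \<beta> - 1/2 * (\<alpha>p + \<alpha>m)"
      using assms(10) abs_ge_self[of \<beta>] abs_ge_self[of \<alpha>p] abs_ge_self[of \<alpha>m]
      unfolding distrib_left by linarith
    ultimately show ?thesis by (metis less_irrefl nonzero_eq_divide_eq)
  qed

  \<comment> \<open>The covariance\<close>
  have cov: "integrable M (\<lambda>x. \<eta> t x * L (t + 1) x)"
      "(\<integral>x. \<eta> t x * L (t + 1) x \<partial>M) = 1/2 * (\<alpha>p - \<alpha>m) *
         ((\<integral>x. \<bar>\<eta> 0 x\<bar> \<partial>M) * \<tau> + (\<integral>x. \<bar>\<eta> 0 x\<bar> * Z (\<eta> 0 x) \<partial>M))" for t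
  proof -
    \<comment> \<open>This is \<open>\<eta> t\<close> times the recursion. The terms with
      \<open>\<beta>\<close> and \<open>\<omega>\<close> have mean zero, because
      \<open>\<eta> t\<close> is centred and independent of \<open>L t\<close>; the two terms with
      \<open>a\<close> give the formula.\<close>
    define F where "F x = \<eta> t x * a (\<eta> t x) * L t x + \<beta> * (\<eta> t x * L t x)
      + (\<omega> * \<eta> t x + \<eta> t x * a (\<eta> t x) * Z (\<eta> t x))" for x
    have eq: "AE x in M. \<eta> t x * L (t + 1) x = F x"
      using rec[of t] by eventually_elim (simp add: c_def d_def F_def algebra_simps)
    have "(\<lambda>y. y * a y) \<in> borel_measurable borel" "(\<lambda>y. y :: real) \<in> borel_measurable borel"
      by measurable
    note ints = past[OF this(1) \<eta>a(1)[of t]] past[OF this(2) \<eta>_int(1)[of t]]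
      \<eta>a[of t] \<eta>aZ[of t] \<eta>_int[of t]
    have [measurable]: "F \<in> borel_measurable M" unfolding F_def by measurable
    have F_int: "integrable M F" unfolding F_def using ints by simp
    show "integrable M (\<lambda>x. \<eta> t x * L (t + 1) x)"
      by (rule integrable_cong_AE_imp[OF F_int]) (use eq in auto)
    have "(\<integral>x. \<eta> t x * L (t + 1) x \<partial>M) = (\<integral>x. F x \<partial>M)"
      by (rule integral_cong_AE) (use eq in auto)
    also have "\<dots> = 1/2 * (\<alpha>p - \<alpha>m) * (\<integral>x. \<bar>\<eta> 0 x\<bar> \<partial>M) * \<tau>
        + 1/2 * (\<alpha>p - \<alpha>m) * (\<integral>x. \<bar>\<eta> 0 x\<bar> * Z (\<eta> 0 x) \<partial>M)"
      unfolding F_def using ints by (simp add: L_mean)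
    finally show "(\<integral>x. \<eta> t x * L (t + 1) x \<partial>M) = 1/2 * (\<alpha>p - \<alpha>m) *
         ((\<integral>x. \<bar>\<eta> 0 x\<bar> \<partial>M) * \<tau> + (\<integral>x. \<bar>\<eta> 0 x\<bar> * Z (\<eta> 0 x) \<partial>M))"
      by (simp add: algebra_simps)
  qed
  have "covariance M (\<eta> t) (L (t + 1)) = (\<integral>x. \<eta> t x * L (t + 1) x \<partial>M)" for t
  proof -
    \<comment> \<open>Since \<open>\<eta> t\<close> is centred, subtracting the mean of
      \<open>L (t + 1)\<close> only adds a multiple of \<open>\<eta> t\<close>, which integrates to
      zero.\<close>
    have "covariance M (\<eta> t) (L (t + 1)) = (\<integral>x. \<eta> t x * L (t + 1) x - \<tau> * \<eta> t x \<partial>M)"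
      by (simp only: covariance_def \<eta>_int L_mean) (simp add: algebra_simps)
    also have "\<dots> = (\<integral>x. \<eta> t x * L (t + 1) x \<partial>M)"
      using cov(1)[of t] \<eta>_int[of t] by simp
    finally show ?thesis .
  qed
  then have "covariance M (\<eta> (t - 1)) (L t) = 1/2 * (\<alpha>p - \<alpha>m) *
      ((\<integral>x. \<bar>\<eta> 0 x\<bar> \<partial>M) * \<tau> + (\<integral>x. \<bar>\<eta> 0 x\<bar> * Z (\<eta> 0 x) \<partial>M))"
    and "integrable M (\<lambda>x. \<eta> (t - 1) x * L t x)" for t
    using cov[of "t - 1"] by (metis diff_add_cancel)+
  then show ?thesis
    using Z_int absZ_int L_int L_mean \<tau>_eq
    unfolding Let_def Z_def L_def[abs_def] by simp
qed

end
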